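(* For all $n\geq0$, the number of $123$-avoiding Jacobi permutations $\pi\in\mathfrak{S}_n$ whose inverse $\pi^{-1}$ is also Jacobi equals $s_n$, where $s_0=1$ and $s_{n+1}=s_n+\sum_{k=1}^{n-1}s_ks_{n-1-k}$ for all $n\geq0$.
   Context: A permutation of a finite set $S$ of positive integers is a word in which each element of $S$ appears exactly once; $\mathfrak{S}_n$ is the set of permutations of $\{1,\dots,n\}$ (the empty permutation is its own inverse). For a permutation $\pi$ and a letter $x$ of $\pi$, $\rho_\pi(x)$ is the maximal consecutive subword of $\pi$ consisting of the letters immediately to the right of $x$ that are all larger than $x$. $\pi$ is Jacobi if $|\rho_\pi(x)|$ is even for all letters $x$. A permutation $\pi$ avoids a pattern $\sigma$ if no subword of $\pi$ has standardization (relative order) $\sigma$. $\pi^{-1}$ denotes the inverse of $\pi$ in the symmetric group $\mathfrak{S}_n$. *)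

theory Defs
  imports "HOL-Combinatorics.Permutations" "HOL-Library.Sublist"
begin

text \<open>
  A word is a list of positive integers with distinct letters. An element of the symmetric group
  on \<open>{1..n}\<close> is a function \<open>p\<close> with \<open>p permutes {1..n}\<close>; its word is its one-line notation.
\<close>

definition one_line :: "nat \<Rightarrow> (nat \<Rightarrow> nat) \<Rightarrow> nat list" where
  "one_line n p = map p [1..<Suc n]"

text \<open>
  Since letters are distinct, \<open>dropWhile\<close> cuts the word at the unique occurrence of \<open>x\<close>.
\<close>

definition rho :: "nat list \<Rightarrow> nat \<Rightarrow> nat list" where
  "rho w x = takeWhile (\<lambda>y. x < y) (tl (dropWhile (\<lambda>y. y \<noteq> x) w))"

definition jacobi :: "nat list \<Rightarrow> bool" where
  "jacobi w \<longleftrightarrow> (\<forall>x\<in>set w. even (length (rho w x)))"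

definition standardize :: "nat list \<Rightarrow> nat list" where
  "standardize w = map (\<lambda>x. card {y\<in>set w. y \<le> x}) w"

text \<open>Subwords in pattern avoidance need not be consecutive.\<close>

definition avoids :: "nat list \<Rightarrow> nat list \<Rightarrow> bool" where
  "avoids w \<sigma> \<longleftrightarrow> \<not> (\<exists>v. subseq v w \<and> standardize v = \<sigma>)"

text \<open>
  The summation range is empty for \<open>n = 0\<close> and \<open>n = 1\<close>, so truncated subtraction is harmless.
\<close>

fun s_seq :: "nat \<Rightarrow> nat" where
  "s_seq 0 = 1"
| "s_seq (Suc n) = s_seq n + (\<Sum>k = 1..n - 1. s_seq k * s_seq (n - 1 - k))"

end

theory Submission
  imports Defs "HOL-Computational_Algebra.Formal_Power_Series"
begin

text \<open>
  In a 123-avoiding permutation the letters that are not left-to-right minima decrease. Hence the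
  permutation is Jacobi iff each left-to-right minimum is followed by an even number of other
  letters before the next one, and its inverse is Jacobi iff consecutive left-to-right minima
  (starting with a virtual \<open>n + 1\<close>) differ by odd numbers.
  Suppose a prefix of such a permutation has been read, its minimum is \<open>m\<close>, and \<open>2k\<close> letters
  above \<open>m\<close> are still unused. The continuation starts either with the two largest unused letters
  or with a new minimum \<open>m - 2j - 1\<close>, which leaves \<open>2(k + j)\<close> unused letters above it. If \<open>S\<close> is the
  generating function of \<open>s_seq\<close>, this recurrence is solved by the coefficient of
  \<open>X\<^bsup>m - 1\<^esup>\<close> in \<open>S\<^bsup>k + 1\<^esup>\<close>, because \<open>S = 1 + X S + X\<^sup>2 (S - 1) S\<close>.
\<close>

unbundle fps_syntax

section \<open>Powers of the generating function\<close>

text \<open>Integer coefficients give meaning to differences such as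
  \<open>s_fps - 1\<close>.\<close>

definition s_fps :: "int fps" where
  "s_fps = Abs_fps (\<lambda>n. int (s_seq n))"

lemma s_fps_nth [simp]: "s_fps $ n = int (s_seq n)"
  by (simp add: s_fps_def)

text \<open>The sum in \<open>s_seq\<close> starts at \<open>k = 1\<close>; the factor
  \<open>s_fps - 1\<close> drops the term \<open>k = 0\<close> of the convolution
  accordingly.\<close>

lemma s_fps_eq: "s_fps = 1 + fps_X * s_fps + fps_X * (fps_X * ((s_fps - 1) * s_fps))"
proof (rule fps_ext)
  fix n
  consider "n = 0" | "n = 1" | k where "n = Suc (Suc k)"
    by (metis One_nat_def not0_implies_Suc)
  then show "s_fps $ n = (1 + fps_X * s_fps + fps_X * (fps_X * ((s_fps - 1) * s_fps))) $ n"
  proof cases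
    case (3 k)
    have "((s_fps - 1) * s_fps) $ k = (\<Sum>i=0..k. (s_fps - 1) $ i * s_fps $ (k - i))"
      by (rule fps_mult_nth)
    also have "\<dots> = (\<Sum>i=1..k. (s_fps - 1) $ i * s_fps $ (k - i))"
      by (rule sum.mono_neutral_right) (auto simp: not_less_eq_eq)
    also have "\<dots> = (\<Sum>i=1..k. int (s_seq i * s_seq (k - i)))"
      by (rule sum.cong) auto
    finally show ?thesis
      using 3 by simp
  qed auto
qed

text \<open>The functional equation, solved for \<open>s_fps - 1\<close>, is multiplied by
  \<open>s_fps ^ k\<close>. The same difference with \<open>k + 1\<close> for \<open>k\<close>
  reappears behind two factors \<open>fps_X\<close>, which drives the two-step induction
  below.\<close>

lemma s_fps_power_step:
  "s_fps ^ Suc k - s_fps ^ k =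
     fps_X * (s_fps ^ Suc k + fps_X * (s_fps ^ Suc (Suc k) - s_fps ^ Suc k))"
proof -
  have "s_fps ^ Suc k - s_fps ^ k = s_fps ^ k * (s_fps - 1)"
    by (simp add: algebra_simps)
  also have "s_fps - 1 = fps_X * s_fps + fps_X * (fps_X * ((s_fps - 1) * s_fps))"
    using s_fps_eq by (metis add.assoc add_diff_cancel_left')
  finally show ?thesis
    by (simp add: algebra_simps)
qed

text \<open>From \<open>r\<close> to \<open>r + 2\<close>, the summand \<open>x = r + 1\<close>
  splits off and the others form the sum for \<open>r\<close> with \<open>k + 1\<close>. The sum
  will collect the continuations in which a new minimum \<open>x + 1\<close> follows the current
  minimum \<open>r + 1\<close>.\<close>

lemma sum_s_fps_power_nth:
  "(\<Sum>x | x < r \<and> odd (r - x). (s_fps ^ Suc (k + (r - x) div 2)) $ x) =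
     (s_fps ^ Suc k - s_fps ^ k) $ r"
proof (induction r arbitrary: k rule: induct_nat_012)
  case 0
  then show ?case by (simp add: fps_power_zeroth)
next
  case 1
  have "{x. x < Suc 0 \<and> odd (Suc 0 - x)} = {0}" by auto
  then show ?case
    by (subst s_fps_power_step) simp
next
  case (ge2 r)
  have "{x. x < Suc (Suc r) \<and> odd (Suc (Suc r) - x)} = insert (Suc r) {x. x < r \<and> odd (r - x)}"
    by (auto simp: less_Suc_eq Suc_diff_le)
  then have "(\<Sum>x | x < Suc (Suc r) \<and> odd (Suc (Suc r) - x).
                (s_fps ^ Suc (k + (Suc (Suc r) - x) div 2)) $ x) =
      (s_fps ^ Suc k) $ Suc r +
      (\<Sum>x | x < r \<and> odd (r - x). (s_fps ^ Suc (k + (Suc (Suc r) - x) div 2)) $ x)"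
    by simp
  also have "(\<Sum>x | x < r \<and> odd (r - x). (s_fps ^ Suc (k + (Suc (Suc r) - x) div 2)) $ x) =
      (\<Sum>x | x < r \<and> odd (r - x). (s_fps ^ Suc (Suc k + (r - x) div 2)) $ x)"
    by (rule sum.cong) (auto simp: Suc_diff_le simp del: power_Suc)
  also have "\<dots> = (s_fps ^ Suc (Suc k) - s_fps ^ Suc k) $ r"
    by (rule ge2.IH)
  finally show ?case
    by (subst s_fps_power_step) (simp del: power_Suc)
qed

section \<open>Counting words by their left-to-right minima\<close>

text \<open>Here \<open>m\<close> is the minimum of the letters already read. A letter that is not a
  new minimum exceeds everything after it, so its own run is empty and needs no parity test.\<close>

fun odd_minima :: "nat \<Rightarrow> nat list \<Rightarrow> bool" where
  "odd_minima m [] = True"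
| "odd_minima m (x # w) =
     (if x < m
      then odd (m - x) \<and> even (length (takeWhile (\<lambda>y. x < y) w)) \<and> odd_minima x w
      else (\<forall>y\<in>set w. y < x) \<and> odd_minima m w)"

definition continuations :: "nat \<Rightarrow> nat set \<Rightarrow> nat list set" where
  "continuations m H = {w. distinct w \<and> set w = {1..<m} \<union> H \<and> odd_minima m w \<and>
                          even (length (takeWhile (\<lambda>y. m < y) w))}"

section \<open>Recurrence by the first letter\<close>

lemma finite_continuations: "finite H \<Longrightarrow> finite (continuations m H)"
  by (rule finite_subset[OF _ finite_subset_distinct[of "{1..<m} \<union> H"]])
     (auto simp: continuations_def)

text \<open>The run of \<open>m\<close> ends at once, the letters strictly between \<open>x\<close>
  and \<open>m\<close> join those above the minimum, and the parity of the run of \<open>x\<close>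
  becomes the last condition on \<open>w\<close>.\<close>

lemma Cons_in_continuations_min_iff:
  assumes "H \<subseteq> {m<..}" "x < m" "1 \<le> x"
  shows "x # w \<in> continuations m H \<longleftrightarrow> odd (m - x) \<and> w \<in> continuations x ({x<..<m} \<union> H)"
proof -
  have "distinct (x # w) \<and> set (x # w) = {1..<m} \<union> H \<longleftrightarrow>
        distinct w \<and> set w = {1..<x} \<union> ({x<..<m} \<union> H)"
  proof -
    have "{1..<m} \<union> H = insert x ({1..<x} \<union> ({x<..<m} \<union> H))"
      using assms by auto
    moreover have "x \<notin> {1..<x} \<union> ({x<..<m} \<union> H)"
      using assms by auto
    ultimately show ?thesis
      by (metis distinct.simps(2) insert_ident list.simps(15))
  qed
  moreover have "x # w \<in> continuations m H \<longleftrightarrow>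
      (distinct (x # w) \<and> set (x # w) = {1..<m} \<union> H) \<and>
      odd (m - x) \<and> even (length (takeWhile (\<lambda>y. x < y) w)) \<and> odd_minima x w"
    unfolding continuations_def mem_Collect_eq using assms(2)
    by (simp only: odd_minima.simps takeWhile.simps) simp
  ultimately show ?thesis
    unfolding continuations_def mem_Collect_eq by blast
qed

text \<open>The run above \<open>m\<close> starts with \<open>x\<close> and has even length, so a
  second letter \<open>y\<close> follows in it. Both exceed everything after them, hence are the two
  largest elements of \<open>H\<close>; removing them preserves parity.\<close>

lemma Cons_in_continuations_non_minD:
  assumes "H \<subseteq> {m<..}" "finite H" "x \<ge> m" "x # w \<in> continuations m H"
  obtains y v where "w = y # v" "x = Max H" "y = Max (H - {x})" "x \<in> H" "y \<in> H - {x}"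
    "v \<in> continuations m (H - {x, y})"
proof -
  have xw: "distinct (x # w)" "set (x # w) = {1..<m} \<union> H" "\<forall>z\<in>set w. z < x" "odd_minima m w"
    "even (length (takeWhile (\<lambda>y. m < y) (x # w)))"
    using assms by (auto simp: continuations_def)
  have "x \<in> {1..<m} \<union> H" using xw(2) by (metis list.set_intros(1))
  then have "x \<in> H" using assms(3) by auto
  then have "m < x" using assms by auto
  then have odd_run: "odd (length (takeWhile (\<lambda>y. m < y) w))" using xw(5) by simp
  then obtain y v where w: "w = y # v" and "m < y"
    by (cases w) (auto split: if_splits)
  have v: "\<forall>z\<in>set v. z < y" "odd_minima m v" "even (length (takeWhile (\<lambda>y. m < y) v))"
    using xw(4) \<open>m < y\<close> odd_run by (auto simp: w)
  have "set v = set (x # w) - {x, y}" using xw(1) by (auto simp: w)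
  also have "\<dots> = {1..<m} \<union> H - {x, y}" by (simp only: xw(2))
  also have "\<dots> = {1..<m} \<union> (H - {x, y})" using \<open>m < y\<close> \<open>m < x\<close> by auto
  finally have setv: "set v = {1..<m} \<union> (H - {x, y})" .
  have "y \<in> {1..<m} \<union> H" unfolding xw(2)[symmetric] by (simp add: w)
  then have y: "y \<in> H - {x}" using \<open>m < y\<close> xw(1) by (auto simp: w)
  have "x = Max H"
  proof (rule Max_eqI[symmetric])
    fix z assume "z \<in> H"
    then have "z \<in> set (x # w)" unfolding xw(2) by simp
    then show "z \<le> x" using xw(3) by (auto intro: less_imp_le)
  qed (use assms \<open>x \<in> H\<close> in auto)
  moreover have "y = Max (H - {x})"
  proof (rule Max_eqI[symmetric])
    show "z \<le> y" if "z \<in> H - {x}" for z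
      using that v(1) setv by (cases "z = y") (auto intro: less_imp_le)
  qed (use assms y in auto)
  moreover have "v \<in> continuations m (H - {x, y})"
    using xw(1) v setv by (simp add: continuations_def w)
  ultimately show ?thesis
    using that w \<open>x \<in> H\<close> y by blast
qed

text \<open>Converse direction: every letter of \<open>v\<close> lies below \<open>m\<close> or in
  \<open>H - {x, y}\<close>, hence below \<open>y\<close>.\<close>

lemma Cons_Cons_in_continuations:
  assumes H: "H \<subseteq> {m<..}" "finite H" "x \<in> H" "y \<in> H - {x}"
    and max: "x = Max H" "y = Max (H - {x})" and v: "v \<in> continuations m (H - {x, y})"
  shows "x # y # v \<in> continuations m H"
proof -
  have le: "z \<le> x" if "z \<in> H" for z
    using that H max by simp
  have le': "z \<le> y" if "z \<in> H - {x}" for z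
    using that H(2) max(2) by simp
  have lt: "m < x" "m < y" "y < x"
    using H le[of y] by auto
  have v_lt: "z < y" if "z \<in> set v" for z
  proof (cases "z \<in> H")
    case True
    then show ?thesis
      using that v le'[of z] H by (force simp: continuations_def)
  next
    case False
    then show ?thesis
      using that v \<open>m < y\<close> by (auto simp: continuations_def)
  qed
  have v_lt': "z < x" if "z \<in> set (y # v)" for z
    using that v_lt[of z] lt(3) by auto
  have "set (x # y # v) = {1..<m} \<union> H"
    using v H by (auto simp: continuations_def)
  moreover have "distinct (x # y # v)"
    using v lt by (auto simp: continuations_def)
  moreover have "odd_minima m (x # y # v)"
  proof -
    have "\<not> x < m" "\<not> y < m" using lt by auto
    moreover have "odd_minima m v" using v by (simp add: continuations_def)
    ultimately show ?thesis using v_lt v_lt' by simp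
  qed
  moreover have "even (length (takeWhile (\<lambda>z. m < z) (x # y # v)))"
    using v lt by (simp add: continuations_def)
  ultimately show ?thesis
    by (simp only: continuations_def mem_Collect_eq)
qed

lemma second_Max_in:
  fixes H :: "'a::linorder set"
  assumes "finite H" "H \<noteq> {}" "even (card H)"
  shows "Max (H - {Max H}) \<in> H - {Max H}"
proof (rule Max_in)
  have "card (H - {Max H}) = card H - 1" "card H \<noteq> 0"
    using assms by simp_all
  then have "card (H - {Max H}) \<noteq> 0"
    using assms(3) by (cases "card H") (auto intro: odd_pos)
  then show "H - {Max H} \<noteq> {}" by (metis card.empty)
qed (use assms in simp)

lemma continuations_decompose:
  assumes "H \<subseteq> {m<..}" "finite H" "m \<ge> 1" "even (card H)"
  shows "continuations m H =
    (\<Union>x\<in>{x. 1 \<le> x \<and> x < m \<and> odd (m - x)}. (#) x ` continuations x ({x<..<m} \<union> H)) \<union>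
    (if H = {} then if m = 1 then {[]} else {}
     else (\<lambda>w. Max H # Max (H - {Max H}) # w) `
       continuations m (H - {Max H, Max (H - {Max H})}))"
    (is "_ = ?A \<union> ?B")
proof (intro set_eqI iffI)
  fix w assume w: "w \<in> continuations m H"
  show "w \<in> ?A \<union> ?B"
  proof (cases w)
    case Nil
    then have "{1..<m} \<union> H = {}" using w by (auto simp: continuations_def)
    then have "H = {}" "m = 1" using assms(3) by auto
    then show ?thesis using Nil by simp
  next
    case (Cons x v)
    show ?thesis
    proof (cases "x < m")
      case True
      have "1 \<le> x" using w assms True by (auto simp: continuations_def Cons)
      with True w assms(1) show ?thesis
        unfolding Cons by (auto simp: Cons_in_continuations_min_iff)
    next
      case False
      then obtain y u where "v = y # u" "x = Max H" "y = Max (H - {x})" "x \<in> H"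
        "u \<in> continuations m (H - {x, y})"
        using Cons_in_continuations_non_minD[OF assms(1,2), of x v] w Cons by (metis not_less)
      then show ?thesis using Cons by auto
    qed
  qed
next
  fix w assume "w \<in> ?A \<union> ?B"
  then show "w \<in> continuations m H"
  proof
    assume "w \<in> ?A"
    then show ?thesis
      using assms(1) by (auto simp: Cons_in_continuations_min_iff)
  next
    assume B: "w \<in> ?B"
    show ?thesis
    proof (cases "H = {}")
      case True
      then show ?thesis using B by (auto simp: continuations_def split: if_splits)
    next
      case False
      then have "Max H \<in> H" using assms by simp
      moreover have "Max (H - {Max H}) \<in> H - {Max H}"
        using second_Max_in assms(2,4) False by blast
      ultimately show ?thesis
        using B False Cons_Cons_in_continuations[OF assms(1,2)] by auto
    qed
  qed
qed

lemma card_continuations: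
  assumes "H \<subseteq> {m<..}" "finite H" "m \<ge> 1" "even (card H)"
  shows "int (card (continuations m H)) = (s_fps ^ Suc (card H div 2)) $ (m - 1)"
  using assms
proof (induction "m + card H" arbitrary: m H rule: less_induct)
  case less
  let ?I = "{x. 1 \<le> x \<and> x < m \<and> odd (m - x)}"
  let ?A = "\<Union>x\<in>?I. (#) x ` continuations x ({x<..<m} \<union> H)"
  let ?B = "if H = {} then if m = 1 then {[]} else {}
     else (\<lambda>w. Max H # Max (H - {Max H}) # w) `
       continuations m (H - {Max H, Max (H - {Max H})})"
  define k where "k = card H div 2"
  have cardH: "card H = 2 * k" using less.prems by (simp add: k_def)
  have "card (continuations m H) = card ?A + card ?B"
  proof -
    have "finite ?A"
      using less.prems by (auto intro!: finite_continuations)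
    moreover have "finite ?B"
      using less.prems by (auto intro!: finite_continuations)
    \<comment> \<open>Words in \<open>?A\<close> start below \<open>m\<close>, words in
      \<open>?B\<close> start above \<open>m\<close> or are empty.\<close>
    moreover have "?A \<inter> ?B = {}"
    proof (cases "H = {}")
      case False
      then have "Max H \<in> {m<..}" using less.prems Max_in[of H] by blast
      then show ?thesis using False by auto
    qed auto
    ultimately show ?thesis
      using continuations_decompose[OF less.prems] card_Un_disjoint[of ?A ?B] by simp
  qed
  moreover have "int (card ?A) = (s_fps ^ Suc k - s_fps ^ k) $ (m - 1)"
  proof -
    have "card ?A = (\<Sum>x\<in>?I. card ((#) x ` continuations x ({x<..<m} \<union> H)))"
      by (rule card_UN_disjoint) (use less.prems in \<open>auto intro!: finite_continuations\<close>)
    also have "\<dots> = (\<Sum>x\<in>?I. card (continuations x ({x<..<m} \<union> H)))"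
      by (simp add: card_image)
    finally have "int (card ?A) = (\<Sum>x\<in>?I. int (card (continuations x ({x<..<m} \<union> H))))"
      by simp
    also have "\<dots> = (\<Sum>x\<in>?I. (s_fps ^ Suc (k + (m - x) div 2)) $ (x - 1))"
    proof (rule sum.cong)
      fix x assume x: "x \<in> ?I"
      have card: "card ({x<..<m} \<union> H) = m - Suc x + 2 * k"
        using less.prems by (subst card_Un_disjoint) (auto simp: cardH)
      have "int (card (continuations x ({x<..<m} \<union> H))) =
          (s_fps ^ Suc (card ({x<..<m} \<union> H) div 2)) $ (x - 1)"
        by (rule less.hyps) (use x less.prems card cardH in auto)
      \<comment> \<open>As \<open>m - x\<close> is odd, the \<open>m - x - 1\<close> letters
        strictly between are even in number.\<close>
      also have "card ({x<..<m} \<union> H) div 2 = k + (m - x) div 2"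
      proof -
        obtain j where "m - x = 2 * j + 1"
          using x by (simp only: mem_Collect_eq) (meson oddE)
        then have "m - Suc x = 2 * j" "(m - x) div 2 = j" by simp_all
        then show ?thesis unfolding card by simp
      qed
      finally show "int (card (continuations x ({x<..<m} \<union> H))) =
          (s_fps ^ Suc (k + (m - x) div 2)) $ (x - 1)" .
    qed simp
    \<comment> \<open>Shift from letters, which start at 1, to exponents, which start at 0.\<close>
    also have "\<dots> = (\<Sum>x | x < m - 1 \<and> odd (m - 1 - x).
        (s_fps ^ Suc (k + (m - 1 - x) div 2)) $ x)"
      by (rule sum.reindex_bij_witness[of _ Suc "\<lambda>x. x - 1"]) auto
    also have "\<dots> = (s_fps ^ Suc k - s_fps ^ k) $ (m - 1)"
      by (rule sum_s_fps_power_nth)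
    finally show ?thesis .
  qed
  moreover have "int (card ?B) = (s_fps ^ k) $ (m - 1)"
  \<comment> \<open>For \<open>H = {}\<close> only the empty word at \<open>m = 1\<close> counts,
    matching \<open>s_fps ^ 0 = 1\<close>.\<close>
  proof (cases "H = {}")
    case True
    then show ?thesis using less.prems by (auto simp: k_def)
  next
    case False
    define a where "a = Max H"
    define b where "b = Max (H - {a})"
    have "a \<in> H" using False less.prems by (simp add: a_def)
    moreover have "b \<in> H - {a}"
      unfolding a_def b_def using second_Max_in less.prems(2,4) False by blast
    ultimately have "card (H - {a, b}) = 2 * (k - 1)"
      using cardH less.prems by (subst card_Diff_subset) auto
    moreover have "k > 0" using cardH False less.prems by (cases k) auto
    ultimately have "int (card (continuations m (H - {a, b}))) = (s_fps ^ Suc (k - 1)) $ (m - 1)"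
      using less.hyps[of m "H - {a, b}"] less.prems cardH \<open>k > 0\<close> by auto
    then show ?thesis
      using False \<open>k > 0\<close> by (simp add: card_image inj_on_def a_def b_def)
  qed
  ultimately show ?case by (simp add: k_def)
qed

section \<open>Jacobi permutations and their inverses\<close>

text \<open>
  Here \<open>U\<close> is the set of letters to the left of \<open>x\<close>, \<open>w\<close> the subword to its right, and all letters
  are below \<open>N\<close>. The last conjunct is the Jacobi condition of the inverse at the position of \<open>x\<close>: in
  the inverse, the run after that position ends just before the smallest larger letter that lies
  to the left of \<open>x\<close>.
\<close>

definition letter_ok :: "nat \<Rightarrow> nat set \<Rightarrow> nat \<Rightarrow> nat list \<Rightarrow> bool" where
  "letter_ok N U x w \<longleftrightarrow> (\<forall>a\<in>U. a < x \<longrightarrow> (\<forall>c\<in>set w. c \<le> x)) \<and>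
     even (length (takeWhile (\<lambda>y. x < y) w)) \<and> odd (Min (insert N {y\<in>U. x < y}) - x)"

fun suffix_ok :: "nat \<Rightarrow> nat set \<Rightarrow> nat list \<Rightarrow> bool" where
  "suffix_ok N U [] = True"
| "suffix_ok N U (x # w) \<longleftrightarrow> letter_ok N U x w \<and> suffix_ok N (insert x U) w"

text \<open>If \<open>x\<close> is a new minimum, nothing in \<open>U\<close> lies below it and the
  two parity conditions remain. Otherwise the minimum of \<open>U\<close> lies below
  \<open>x\<close>, so avoidance makes all later letters smaller, and this in turn implies both
  parity conditions.\<close>

lemma suffix_ok_iff_odd_minima:
  assumes "U \<union> set w = {1..<N}" "distinct w" "U \<inter> set w = {}"
  shows "suffix_ok N U w \<longleftrightarrow> odd_minima (Min (insert N U)) w"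
  using assms
proof (induction w arbitrary: U)
  case Nil
  then show ?case by simp
next
  case (Cons x w)
  define m where "m = Min (insert N U)"
  have fin: "finite U" using Cons.prems by (metis finite_Un finite_atLeastLessThan)
  have "x < N" using Cons.prems by auto
  have IH: "suffix_ok N (insert x U) w \<longleftrightarrow> odd_minima (Min (insert N (insert x U))) w"
    by (rule Cons.IH) (use Cons.prems in auto)
  have "m \<in> insert N U" unfolding m_def by (rule Min_in) (use fin in auto)
  then have "x \<noteq> m" using Cons.prems \<open>x < N\<close> by auto
  have min': "Min (insert N (insert x U)) = min x m"
    unfolding m_def using fin by (subst insert_commute, subst Min_insert) auto
  show ?case
  proof (cases "x < m")
    case True
    then have gt: "x < y" if "y \<in> U" for y
      using that fin unfolding m_def by simp
    then have "{y\<in>U. x < y} = U" by auto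
    moreover have "\<forall>a\<in>U. \<not> a < x" using gt by force
    ultimately have "letter_ok N U x w \<longleftrightarrow> even (length (takeWhile (\<lambda>y. x < y) w)) \<and> odd (m - x)"
      unfolding letter_ok_def m_def by auto
    then show ?thesis
      using True IH min' by (auto simp: m_def[symmetric] min_def)
  next
    case False
    then have "m < x" "m \<in> U" using \<open>x \<noteq> m\<close> \<open>m \<in> insert N U\<close> \<open>x < N\<close> by auto
    have "letter_ok N U x w \<longleftrightarrow> (\<forall>y\<in>set w. y < x)"
    proof
      assume "letter_ok N U x w"
      then have "\<forall>y\<in>set w. y \<le> x" using \<open>m < x\<close> \<open>m \<in> U\<close> by (auto simp: letter_ok_def)
      then show "\<forall>y\<in>set w. y < x" using Cons.prems(2) by (auto simp: order.strict_iff_order)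
    next
      assume lt: "\<forall>y\<in>set w. y < x"
      \<comment> \<open>No letter after \<open>x\<close> is larger, so \<open>x + 1\<close> is
        already used or is the bound \<open>N\<close>; the difference in \<open>letter_ok\<close> is
        therefore 1.\<close>
      have "Suc x \<in> insert N U"
      proof (cases "Suc x = N")
        case False
        then have "Suc x \<in> U \<union> set (x # w)" using \<open>x < N\<close> unfolding Cons.prems by auto
        then show ?thesis using lt by force
      qed simp
      then have "Min (insert N {y\<in>U. x < y}) = Suc x"
        by (intro Min_eqI) (use fin \<open>x < N\<close> in auto)
      moreover have "takeWhile (\<lambda>y. x < y) w = []"
        using lt by (cases w) auto
      ultimately show "letter_ok N U x w"
        using lt by (auto simp: letter_ok_def intro: less_imp_le)
    qed
    then show ?thesis
      using False IH min' by (auto simp: m_def[symmetric] min_def)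
  qed
qed

text \<open>Trades the recursion along the word for a condition at each position, the form that the
  Jacobi and avoidance conditions take.\<close>

lemma suffix_ok_map_upt:
  assumes "i \<ge> 1" "i \<le> Suc n"
  shows "suffix_ok N (p ` {1..<i}) (map p [i..<Suc n]) \<longleftrightarrow>
    (\<forall>j\<in>{i..n}. letter_ok N (p ` {1..<j}) (p j) (map p [Suc j..<Suc n]))"
  using assms(2,1)
proof (induction i rule: inc_induct)
  case base
  then show ?case by simp
next
  case (step i)
  have "insert (p i) (p ` {1..<i}) = p ` {1..<Suc i}"
    using step.prems by (auto simp: less_Suc_eq)
  moreover have "{i..n} = insert i {Suc i..n}" using step.hyps by auto
  moreover have "[i..<Suc n] = i # [Suc i..<Suc n]" using step.hyps by (simp add: upt_conv_Cons)
  ultimately show ?case using step by simp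
qed

section \<open>The Jacobi condition by position, for a word and for the inverse\<close>

lemma upt_split: "i \<le> j \<Longrightarrow> j < n \<Longrightarrow> [i..<n] = [i..<j] @ j # [Suc j..<n]"
  using upt_add_eq_append[of i j "n - j"] by (simp add: upt_conv_Cons)

lemma jacobi_map_upt:
  assumes "inj_on f {1..n}"
  shows "jacobi (map f [1..<Suc n]) \<longleftrightarrow>
    (\<forall>i\<in>{1..n}. even (length (takeWhile (\<lambda>y. f i < y) (map f [Suc i..<Suc n]))))"
proof -
  have "rho (map f [1..<Suc n]) (f i) = takeWhile (\<lambda>y. f i < y) (map f [Suc i..<Suc n])"
    if i: "i \<in> {1..n}" for i
  proof -
    have "[1..<Suc n] = [1..<i] @ i # [Suc i..<Suc n]"
      using i by (intro upt_split) auto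
    \<comment> \<open>By injectivity \<open>f i\<close> does not occur before position
      \<open>i\<close>.\<close>
    moreover have "dropWhile (\<lambda>y. y \<noteq> f i) (map f [1..<i] @ f i # u) = f i # u" for u
    proof (rule dropWhile_append2[THEN trans])
      fix y assume "y \<in> set (map f [1..<i])"
      then obtain j where "y = f j" "1 \<le> j" "j < i" by auto
      then show "y \<noteq> f i" using i inj_onD[OF assms, of j i] by auto
    qed simp
    ultimately have "dropWhile (\<lambda>y. y \<noteq> f i) (map f [1..<Suc n]) = f i # map f [Suc i..<Suc n]"
      by (simp add: dropWhile_append2 del: upt_Suc)
    then show ?thesis by (simp add: rho_def)
  qed
  moreover have "set (map f [1..<Suc n]) = f ` {1..n}"
    by (simp add: atLeastLessThanSuc_atLeastAtMost del: upt_Suc)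
  ultimately show ?thesis by (simp add: jacobi_def)
qed

text \<open>The run stops at the least value violating \<open>P\<close>; inserting \<open>b\<close>
  covers the case of no violation.\<close>

lemma length_takeWhile_upt:
  "a \<le> b \<Longrightarrow> length (takeWhile P [a..<b]) = Min (insert b {v. a \<le> v \<and> v < b \<and> \<not> P v}) - a"
proof (induction a rule: inc_induct)
  case base
  then show ?case by (simp add: Min_eqI)
next
  case (step a)
  let ?M = "\<lambda>a. insert b {v. a \<le> v \<and> v < b \<and> \<not> P v}"
  show ?case
  proof (cases "P a")
    case True
    then have "?M a = ?M (Suc a)"
      by (auto simp: Suc_le_eq order.strict_iff_order)
    moreover have "a < Min (?M (Suc a))"
      using step by (subst Min_gr_iff) auto
    then have "Suc (Min (?M (Suc a)) - Suc a) = Min (?M (Suc a)) - a"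
      by (rule Suc_diff_Suc)
    ultimately show ?thesis
      using True step by (simp add: upt_conv_Cons)
  next
    case False
    then have "Min (?M a) = a"
      using step by (intro Min_eqI) auto
    then show ?thesis using False step by (simp add: upt_conv_Cons)
  qed
qed

text \<open>The inverse has letter \<open>i\<close> at position \<open>p i\<close>. The run after it
  stops at the first later position \<open>v\<close> with \<open>inv p v < i\<close>, that is, at
  the least larger letter of \<open>p\<close> to the left of position \<open>i\<close>.\<close>

lemma jacobi_inv_iff:
  assumes p: "p permutes {1..n}"
  shows "jacobi (one_line n (inv p)) \<longleftrightarrow>
    (\<forall>i\<in>{1..n}. odd (Min (insert (Suc n) {y\<in>p ` {1..<i}. p i < y}) - p i))"
proof -
  have inv_in: "inv p x \<in> {1..n} \<longleftrightarrow> x \<in> {1..n}" for x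
    using permutes_in_image[OF permutes_inv[OF p]] .
  have p_in: "p x \<in> {1..n} \<longleftrightarrow> x \<in> {1..n}" for x
    using permutes_in_image[OF p] .
  have "length (takeWhile (\<lambda>y. inv p (p i) < y) (map (inv p) [Suc (p i)..<Suc n])) =
      Min (insert (Suc n) {y\<in>p ` {1..<i}. p i < y}) - Suc (p i)" if i: "i \<in> {1..n}" for i
  proof -
    have "p i \<in> {1..n}" using p_in i by simp
    then have "length (takeWhile (\<lambda>y. inv p (p i) < y) (map (inv p) [Suc (p i)..<Suc n])) =
       Min (insert (Suc n) {v. Suc (p i) \<le> v \<and> v < Suc n \<and> \<not> inv p (p i) < inv p v}) - Suc (p i)"
      by (simp add: takeWhile_map length_takeWhile_upt comp_def del: upt_Suc)
    also have "{v. Suc (p i) \<le> v \<and> v < Suc n \<and> \<not> inv p (p i) < inv p v} =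
        {y\<in>p ` {1..<i}. p i < y}" (is "?L = ?R")
    proof (intro equalityI subsetI)
      fix v assume v: "v \<in> ?L"
      then have "inv p v \<in> {1..n}" using inv_in[of v] by simp
      moreover have "inv p v \<noteq> i"
        using v permutes_inverses(1)[OF p, of v] by auto
      ultimately have "inv p v \<in> {1..<i}"
        using v permutes_inverses(2)[OF p] by auto
      then show "v \<in> ?R"
        using v permutes_inverses(1)[OF p, of v] by (force intro: image_eqI[of _ _ "inv p v"])
    next
      fix v assume v: "v \<in> ?R"
      then obtain j where j: "v = p j" "1 \<le> j" "j < i" by auto
      then show "v \<in> ?L"
        using v i p_in[of j] permutes_inverses(2)[OF p] by auto
    qed
    finally show ?thesis .
  qed
  note len = this
  have eq: "even (length (takeWhile (\<lambda>y. inv p (p i) < y) (map (inv p) [Suc (p i)..<Suc n])))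
      \<longleftrightarrow> odd (Min (insert (Suc n) {y\<in>p ` {1..<i}. p i < y}) - p i)" if "i \<in> {1..n}" for i
  proof -
    \<comment> \<open>The truncated difference is thus positive, and replacing
      \<open>Suc (p i)\<close> by \<open>p i\<close> flips its parity.\<close>
    have "p i < Min (insert (Suc n) {y\<in>p ` {1..<i}. p i < y})"
      using p_in[of i] that by (subst Min_gr_iff) auto
    then show ?thesis
      unfolding len[OF that] by (simp only: Suc_diff_Suc[symmetric] even_Suc not_not)
  qed
  have "jacobi (one_line n (inv p)) \<longleftrightarrow> (\<forall>x\<in>p ` {1..n}. even (length (takeWhile (\<lambda>y. inv p x < y)
      (map (inv p) [Suc x..<Suc n]))))"
    unfolding one_line_def
    using jacobi_map_upt[of "inv p" n] permutes_inj_on[OF permutes_inv[OF p]] permutes_image[OF p]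
    by simp
  then show ?thesis using eq by (simp only: ball_simps cong: ball_cong)
qed

section \<open>Occurrences of the pattern 123\<close>

lemma standardize_eq_123_iff:
  "standardize v = [1, 2, 3] \<longleftrightarrow> (\<exists>a b c. v = [a, b, c] \<and> a < b \<and> b < c)"
proof
  assume v: "standardize v = [1, 2, 3]"
  define r where "r x = card {y\<in>set v. y \<le> x}" for x
  \<comment> \<open>Ranks are monotone, so strictly increasing ranks force strictly increasing
    letters.\<close>
  have mono: "r x \<le> r y" if "x \<le> y" for x y
    unfolding r_def using that by (intro card_mono) auto
  have "map r v = [1, 2, 3]" using v by (simp add: standardize_def r_def[abs_def])
  then obtain a b c where "v = [a, b, c]" "r a = 1" "r b = 2" "r c = 3"
    by (auto simp: map_eq_Cons_conv)
  then show "\<exists>a b c. v = [a, b, c] \<and> a < b \<and> b < c"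
    using mono[of b a] mono[of c b] by force
next
  assume "\<exists>a b c. v = [a, b, c] \<and> a < b \<and> b < c"
  then obtain a b c where v: "v = [a, b, c]" "a < b" "b < c" by blast
  have "{y \<in> set v. y \<le> a} = {a}" "{y \<in> set v. y \<le> b} = {a, b}" "{y \<in> set v. y \<le> c} = {a, b, c}"
    using v by auto
  then show "standardize v = [1, 2, 3]"
    using v by (simp add: standardize_def)
qed

text \<open>Occurrences are indexed by the position of the middle letter, to match
  \<open>letter_ok\<close>.\<close>

lemma subseq_three_map_upt_iff:
  "subseq [a, b, c] (map p [1..<Suc n]) \<longleftrightarrow>
     (\<exists>i\<in>{1..n}. a \<in> p ` {1..<i} \<and> b = p i \<and> c \<in> set (map p [Suc i..<Suc n]))"
proof
  assume "subseq [a, b, c] (map p [1..<Suc n])"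
  then obtain xs ys where 1: "map p [1..<Suc n] = xs @ a # ys" "subseq [b, c] ys"
    by (auto dest: list_emb_ConsD)
  then obtain ys1 ys2 where 2: "ys = ys1 @ b # ys2" "subseq [c] ys2"
    by (auto dest: list_emb_ConsD)
  then have c: "c \<in> set ys2" by (simp add: subseq_singleton_left)
  \<comment> \<open>The zero-based position of \<open>b\<close>; since the word lists
    \<open>p\<close> from 1 on, \<open>b = p (Suc k)\<close>.\<close>
  define k where "k = length (xs @ a # ys1)"
  have w: "map p [1..<Suc n] = (xs @ a # ys1) @ b # ys2"
    using 1 2 by simp
  have "k < n"
    using arg_cong[OF w, of length] by (simp add: k_def del: upt_Suc)
  have "map p [1..<Suc k] = xs @ a # ys1"
    using arg_cong[OF w, of "take k"] \<open>k < n\<close> by (simp add: k_def take_map take_upt del: upt_Suc)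
  then have "a \<in> set (map p [1..<Suc k])" by simp
  moreover have "p (Suc k) = b"
    using arg_cong[OF w, of "\<lambda>u. u ! k"] \<open>k < n\<close> by (simp add: k_def nth_append del: upt_Suc)
  moreover have "map p [Suc (Suc k)..<Suc n] = ys2"
    using arg_cong[OF w, of "drop (Suc k)"] by (simp add: k_def drop_map del: upt_Suc)
  ultimately show "\<exists>i\<in>{1..n}. a \<in> p ` {1..<i} \<and> b = p i \<and> c \<in> set (map p [Suc i..<Suc n])"
    using c \<open>k < n\<close> by (intro bexI[of _ "Suc k"]) (auto simp del: upt_Suc)
next
  assume "\<exists>i\<in>{1..n}. a \<in> p ` {1..<i} \<and> b = p i \<and> c \<in> set (map p [Suc i..<Suc n])"
  then obtain i where i: "i \<in> {1..n}" "a \<in> p ` {1..<i}" "b = p i" "c \<in> set (map p [Suc i..<Suc n])"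
    by blast
  have "[1..<Suc n] = [1..<i] @ [i] @ [Suc i..<Suc n]"
    using upt_split[of 1 i "Suc n"] i(1) by simp
  moreover have "subseq ([a] @ [b] @ [c]) (map p [1..<i] @ map p [i] @ map p [Suc i..<Suc n])"
    using i by (intro list_emb_append_mono) (auto simp: subseq_singleton_left)
  ultimately show "subseq [a, b, c] (map p [1..<Suc n])"
    by simp
qed

lemma avoids_123_iff:
  "avoids (map p [1..<Suc n]) [1, 2, 3] \<longleftrightarrow>
     (\<forall>i\<in>{1..n}. \<forall>a\<in>p ` {1..<i}. a < p i \<longrightarrow> (\<forall>c\<in>set (map p [Suc i..<Suc n]). c \<le> p i))"
proof -
  have "avoids (map p [1..<Suc n]) [1, 2, 3] \<longleftrightarrow>
      \<not> (\<exists>a b c. subseq [a, b, c] (map p [1..<Suc n]) \<and> a < b \<and> b < c)"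
    unfolding avoids_def standardize_eq_123_iff by blast
  then show ?thesis
    unfolding subseq_three_map_upt_iff unfolding linorder_not_less[symmetric] by blast
qed

text \<open>The three conditions are, position by position, the three conjuncts of
  \<open>letter_ok\<close>. Reading starts with no letters used and the virtual minimum
  \<open>n + 1\<close>.\<close>

lemma conditions_iff_odd_minima:
  assumes p: "p permutes {1..n}"
  shows "avoids (one_line n p) [1, 2, 3] \<and> jacobi (one_line n p) \<and> jacobi (one_line n (inv p)) \<longleftrightarrow>
    odd_minima (Suc n) (one_line n p)"
proof -
  have "avoids (one_line n p) [1, 2, 3] \<and> jacobi (one_line n p) \<and> jacobi (one_line n (inv p)) \<longleftrightarrow>
      (\<forall>j\<in>{1..n}. letter_ok (Suc n) (p ` {1..<j}) (p j) (map p [Suc j..<Suc n]))"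
    unfolding jacobi_inv_iff[OF p] unfolding one_line_def avoids_123_iff
      jacobi_map_upt[OF permutes_inj_on[OF p]] letter_ok_def by blast
  also have "\<dots> \<longleftrightarrow> suffix_ok (Suc n) {} (one_line n p)"
    using suffix_ok_map_upt[of 1 n "Suc n" p] by (simp add: one_line_def)
  also have "\<dots> \<longleftrightarrow> odd_minima (Min (insert (Suc n) {})) (one_line n p)"
    by (rule suffix_ok_iff_odd_minima)
      (use permutes_image[OF p] permutes_inj_on[OF p] in
        \<open>auto simp: one_line_def distinct_map atLeastLessThanSuc_atLeastAtMost simp del: upt_Suc\<close>)
  finally show ?thesis by simp
qed

section \<open>Passage from permutations to words and the final count\<close>

lemma bij_betw_one_line:
  "bij_betw (one_line n) {p. p permutes {1..n}} {w. distinct w \<and> set w = {1..n}}"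
proof (rule bij_betw_imageI)
  show "inj_on (one_line n) {p. p permutes {1..n}}"
  proof (rule inj_onI)
    fix p q assume pq: "p \<in> {p. p permutes {1..n}}" "q \<in> {p. p permutes {1..n}}"
      "one_line n p = one_line n q"
    then have "p i = q i" if "i \<in> {1..n}" for i
      using that by (auto simp: one_line_def map_eq_conv simp del: upt_Suc)
    moreover have "p i = q i" if "i \<notin> {1..n}" for i
      using that pq by (simp add: permutes_not_in)
    ultimately show "p = q" by blast
  qed
  show "one_line n ` {p. p permutes {1..n}} = {w. distinct w \<and> set w = {1..n}}"
  proof (intro equalityI subsetI)
    fix w assume "w \<in> one_line n ` {p. p permutes {1..n}}"
    then obtain p where "w = one_line n p" and p: "p permutes {1..n}" by auto
    then show "w \<in> {w. distinct w \<and> set w = {1..n}}"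
      using permutes_image[OF p] permutes_inj_on[OF p]
      by (auto simp: one_line_def distinct_map atLeastLessThanSuc_atLeastAtMost simp del: upt_Suc)
  next
    fix w assume w: "w \<in> {w. distinct w \<and> set w = {1..n}}"
    then have len: "length w = n" using distinct_card by fastforce
    define p where "p i = (if i \<in> {1..n} then w ! (i - 1) else i)" for i
    have line: "one_line n p = w"
      by (rule nth_equalityI) (auto simp: one_line_def p_def len simp del: upt_Suc)
    have "set (map p [1..<Suc n]) = {1..n}" "distinct (map p [1..<Suc n])"
      using w line by (auto simp: one_line_def)
    then have "bij_betw p {1..n} {1..n}"
      unfolding bij_betw_def distinct_map by (simp add: atLeastLessThanSuc_atLeastAtMost del: upt_Suc)
    then have "p permutes {1..n}"
      by (rule bij_imp_permutes) (auto simp: p_def)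
    then show "w \<in> one_line n ` {p. p permutes {1..n}}" using line by blast
  qed
qed

theorem theorem6p8:
  fixes n :: nat
  shows "card {p. p permutes {1..n} \<and> avoids (one_line n p) [1, 2, 3] \<and>
                  jacobi (one_line n p) \<and> jacobi (one_line n (inv p))} = s_seq n"
proof -
  let ?P = "{p. p permutes {1..n} \<and> avoids (one_line n p) [1, 2, 3] \<and>
                  jacobi (one_line n p) \<and> jacobi (one_line n (inv p))}"
  have P: "?P = {p. p permutes {1..n} \<and> odd_minima (Suc n) (one_line n p)}"
    using conditions_iff_odd_minima by blast
  \<comment> \<open>No letter exceeds the virtual minimum \<open>n + 1\<close>, so the parity
    condition on its run is vacuous.\<close>
  have "takeWhile (\<lambda>y. Suc n < y) w = []" if "set w = {1..n}" for w
    using that by (subst takeWhile_eq_Nil_iff) (use hd_in_set[of w] in auto)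
  then have "continuations (Suc n) {} = {w. distinct w \<and> set w = {1..n} \<and> odd_minima (Suc n) w}"
    by (auto simp: continuations_def atLeastLessThanSuc_atLeastAtMost)
  also have "\<dots> = {w \<in> one_line n ` {p. p permutes {1..n}}. odd_minima (Suc n) w}"
    unfolding bij_betw_imp_surj_on[OF bij_betw_one_line] by simp
  also have "\<dots> = one_line n ` ?P"
    unfolding P by auto
  finally have "card (continuations (Suc n) {}) = card (one_line n ` ?P)" by simp
  also have "\<dots> = card ?P"
    by (rule card_image) (use bij_betw_one_line[of n] in \<open>auto simp: bij_betw_def inj_on_def\<close>)
  \<comment> \<open>With \<open>m = n + 1\<close> and \<open>H = {}\<close> the count is the
    coefficient of index \<open>n\<close> in \<open>s_fps ^ 1\<close>.\<close>
  finally show ?thesis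
    using card_continuations[of "{}" "Suc n"] by simp
qed

end
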